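(* Let $S$ be a set and $\to\subseteq S\times S$ a binary relation. For all $P,Q\subseteq S$, $F\subseteq S\times S$ and $c:S\to\mathbb{N}$: if $\mathrm{EnsuresN}_{\to}(P,Q,F,c)$ holds, then $\mathrm{Ensures}_{\to}(P,Q,F)$ holds.
   Context: For $n\in\mathbb{N}$, $\to^n$ denotes the $n$-fold composition of $\to$, with $\to^0$ the identity relation on $S$. For $Q\subseteq S$, $\mathrm{Ev}_{\to}(Q)\subseteq S$ is the least set closed under: (1) if $s\in Q$ then $s\in\mathrm{Ev}_{\to}(Q)$; (2) if there exists $s'$ with $s\to s'$ and every $s'$ with $s\to s'$ lies in $\mathrm{Ev}_{\to}(Q)$, then $s\in\mathrm{Ev}_{\to}(Q)$. For $n\in\mathbb{N}$, $\mathrm{EvN}_{\to}(n,Q)=\{s\in S\mid (\forall s'.\ s\to^n s'\Rightarrow s'\in Q)\wedge(\forall s'\,\forall l<n.\ s\to^l s'\Rightarrow\exists s''.\ s'\to s'')\}$. $\mathrm{Ensures}_{\to}(P,Q,F)$ means: for all $s\in P$, $s\in\mathrm{Ev}_{\to}(\{s'\mid s'\in Q\wedge (s,s')\in F\})$. $\mathrm{EnsuresN}_{\to}(P,Q,F,c)$ means: for all $s\in P$, $s\in\mathrm{EvN}_{\to}(c(s),\{s'\mid s'\in Q\wedge (s,s')\in F\})$. *)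

theory Defs
  imports Main
begin

(* R is the transition relation on the state set S. Only EvN mentions S: if R is contained in
   S \<times> S and Q in S, then Ev R Q is contained in S, and for s in S every R ^^ l-successor of s lies
   in S (in particular R ^^ 0 = Id agrees with the identity on S when started in S). *)

inductive_set Ev :: "('s \<times> 's) set \<Rightarrow> 's set \<Rightarrow> 's set"
  for R :: "('s \<times> 's) set" and Q :: "'s set"
where
  now: "s \<in> Q \<Longrightarrow> s \<in> Ev R Q"
| later: "\<exists>s'. (s, s') \<in> R \<Longrightarrow> (\<And>s'. (s, s') \<in> R \<Longrightarrow> s' \<in> Ev R Q) \<Longrightarrow> s \<in> Ev R Q"

definition EvN :: "'s set \<Rightarrow> ('s \<times> 's) set \<Rightarrow> nat \<Rightarrow> 's set \<Rightarrow> 's set" where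
  "EvN S R n Q =
     {s \<in> S. (\<forall>s'. (s, s') \<in> R ^^ n \<longrightarrow> s' \<in> Q) \<and>
             (\<forall>s'. \<forall>l<n. (s, s') \<in> R ^^ l \<longrightarrow> (\<exists>s''. (s', s'') \<in> R))}"

definition Ensures :: "('s \<times> 's) set \<Rightarrow> 's set \<Rightarrow> 's set \<Rightarrow> ('s \<times> 's) set \<Rightarrow> bool" where
  "Ensures R P Q F \<longleftrightarrow> (\<forall>s\<in>P. s \<in> Ev R {s'. s' \<in> Q \<and> (s, s') \<in> F})"

definition EnsuresN ::
    "'s set \<Rightarrow> ('s \<times> 's) set \<Rightarrow> 's set \<Rightarrow> 's set \<Rightarrow> ('s \<times> 's) set \<Rightarrow> ('s \<Rightarrow> nat) \<Rightarrow> bool" where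
  "EnsuresN S R P Q F c \<longleftrightarrow> (\<forall>s\<in>P. s \<in> EvN S R (c s) {s'. s' \<in> Q \<and> (s, s') \<in> F})"

end

theory Submission
  imports Defs
begin

text \<open>Induction on the step bound \<open>n\<close>, with the state varying and the target
  \<open>Q\<close> fixed (\<open>Ev_if_relpow\<close>). Prefixing paths by a step from
  \<open>s\<close> to \<open>t\<close> passes the hypotheses at \<open>s\<close> for
  \<open>Suc n\<close> to \<open>t\<close> for \<open>n\<close>, so every successor of
  \<open>s\<close> lies in \<open>Ev R Q\<close>; as \<open>s\<close> is not stuck, clause
  \<open>later\<close> applies.\<close>

lemma Ev_if_relpow:
  assumes "\<And>s'. (s, s') \<in> R ^^ n \<Longrightarrow> s' \<in> Q"
    and "\<And>l s'. l < n \<Longrightarrow> (s, s') \<in> R ^^ l \<Longrightarrow> \<exists>s''. (s', s'') \<in> R"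
  shows "s \<in> Ev R Q"
  using assms
proof (induction n arbitrary: s)
  case 0
  then show ?case by (simp add: Ev.now)
next
  case (Suc n)
  show ?case
  proof (rule Ev.later)
    \<comment> \<open>Path length 0: \<open>s\<close> itself is not stuck, since
      \<open>0 < Suc n\<close>.\<close>
    show "\<exists>s'. (s, s') \<in> R"
      using Suc.prems(2)[of 0 s] by simp
  next
    fix t assume st: "(s, t) \<in> R"
    show "t \<in> Ev R Q"
    proof (rule Suc.IH)
      fix u assume "(t, u) \<in> R ^^ n"
      with st show "u \<in> Q" by (intro Suc.prems(1) relpow_Suc_I2)
    next
      fix l u assume "l < n" "(t, u) \<in> R ^^ l"
      with st show "\<exists>v. (u, v) \<in> R"
        by (intro Suc.prems(2)[of "Suc l"] relpow_Suc_I2 Suc_mono)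
    qed
  qed
qed

lemma EvN_subset_Ev: "EvN S R n Q \<subseteq> Ev R Q"
  unfolding EvN_def by (auto intro!: Ev_if_relpow)

theorem theorem1:
  fixes S :: "'s set" and R :: "('s \<times> 's) set"
    and P Q :: "'s set" and F :: "('s \<times> 's) set" and c :: "'s \<Rightarrow> nat"
  assumes "R \<subseteq> S \<times> S"
    and "P \<subseteq> S" and "Q \<subseteq> S" and "F \<subseteq> S \<times> S"
    and "EnsuresN S R P Q F c"
  shows "Ensures R P Q F"
  \<comment> \<open>The target set depends on the start state \<open>s\<close>, so the inclusion is
    applied separately for each \<open>s\<close> in \<open>P\<close>, with
    \<open>n = c s\<close>.\<close>
  using assms(5) EvN_subset_Ev unfolding EnsuresN_def Ensures_def by (metis subsetD)

end
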